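(* Let $G$ be a finite simple graph that contains none of $C_4$, $\overline{C_4}$, $S_3$, the chair and the co-chair as an induced subgraph. Then every (finite) oriented graph $D$ missing $G$ has a vertex $v$ with $d^{+}_D(v)\le d^{++}_D(v)$ (i.e. $D$ satisfies Seymour's Second Neighborhood Conjecture).
   Context: An oriented graph is a digraph with no loops, no parallel arcs and no directed cycles of length 2. For a vertex $v$ of an oriented graph $D$, $N^+_D(v)$ is its set of out-neighbours, $N^{++}_D(v)=\{x\in V(D)\setminus N^+_D(v): \exists y\in N^+_D(v),\ (y,x)\in E(D)\}$ is its second out-neighbourhood, $d^+_D(v)=|N^+_D(v)|$ and $d^{++}_D(v)=|N^{++}_D(v)|$. A missing edge of $D$ is a pair $\{x,y\}$ of distinct vertices such that neither $(x,y)$ nor $(y,x)$ is an arc. The missing graph of $D$ is the graph whose edges are the missing edges of $D$ and whose vertices are the vertices incident to at least one missing edge; $D$ is said to be missing $G$ if its missing graph is (isomorphic to) $G$. $C_n$ denotes the cycle on $n$ vertices and $\overline{H}$ the complement of $H$. The chair is the graph with vertex set $\{x,y,z,t,v\}$ and edge set $\{xy,yz,zt,zv\}$; the co-chair is its complement. $S_3$ is the 3-sun: the graph on vertices $a,b,c,p,q,r$ with edges $ab,bc,ca,pa,pb,qb,qc,ra,rc$ (a triangle $abc$ plus three vertices of degree 2, each adjacent to a different pair of triangle vertices). *)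

theory Defs
  imports "Graph_Theory.Graph_Theory"
begin

locale oriented_graph = pair_digraph +
  assumes no_two_cycles: "(u, v) \<in> parcs G \<Longrightarrow> (v, u) \<notin> parcs G"

definition out_nbrs :: "'a pair_pre_digraph \<Rightarrow> 'a \<Rightarrow> 'a set" where
  "out_nbrs D v = {x \<in> pverts D. (v, x) \<in> parcs D}"

definition second_out_nbrs :: "'a pair_pre_digraph \<Rightarrow> 'a \<Rightarrow> 'a set" where
  "second_out_nbrs D v =
     {x \<in> pverts D - out_nbrs D v. \<exists>y \<in> out_nbrs D v. (y, x) \<in> parcs D}"

definition out_deg :: "'a pair_pre_digraph \<Rightarrow> 'a \<Rightarrow> nat" where
  "out_deg D v = card (out_nbrs D v)"

definition second_out_deg :: "'a pair_pre_digraph \<Rightarrow> 'a \<Rightarrow> nat" where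
  "second_out_deg D v = card (second_out_nbrs D v)"


text \<open>
  A finite simple graph is a \<^const>\<open>pair_graph\<close>: an edge \<open>xy\<close> is represented by
  the two arcs \<open>(x, y)\<close> and \<open>(y, x)\<close>.
\<close>

definition missing_arcs :: "'a pair_pre_digraph \<Rightarrow> 'a rel" where
  "missing_arcs D = {(x, y). x \<in> pverts D \<and> y \<in> pverts D \<and> x \<noteq> y
     \<and> (x, y) \<notin> parcs D \<and> (y, x) \<notin> parcs D}"

definition missing_graph :: "'a pair_pre_digraph \<Rightarrow> 'a pair_pre_digraph" where
  "missing_graph D =
     \<lparr>pverts = {x. \<exists>y. (x, y) \<in> missing_arcs D}, parcs = missing_arcs D\<rparr>"

definition is_missing :: "'a pair_pre_digraph \<Rightarrow> 'b pair_pre_digraph \<Rightarrow> bool" where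
  "is_missing D G \<longleftrightarrow> digraph_iso (with_proj (missing_graph D)) (with_proj G)"

definition contains_induced :: "'a pair_pre_digraph \<Rightarrow> 'b pair_pre_digraph \<Rightarrow> bool" where
  "contains_induced G H \<longleftrightarrow>
     (\<exists>K. induced_subgraph K (with_proj G) \<and> digraph_iso K (with_proj H))"

definition graph_complement :: "'a pair_pre_digraph \<Rightarrow> 'a pair_pre_digraph" where
  "graph_complement H =
     \<lparr>pverts = pverts H,
      parcs = {(x, y). x \<in> pverts H \<and> y \<in> pverts H \<and> x \<noteq> y \<and> (x, y) \<notin> parcs H}\<rparr>"

definition graph_of_edges :: "'a set \<Rightarrow> 'a set set \<Rightarrow> 'a pair_pre_digraph" where
  "graph_of_edges V E = \<lparr>pverts = V, parcs = {(x, y). {x, y} \<in> E}\<rparr>"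

text \<open>The cycle on \<open>n\<close> vertices, meaningful for \<open>n \<ge> 3\<close>.\<close>

definition cycle_graph :: "nat \<Rightarrow> nat pair_pre_digraph" where
  "cycle_graph n = graph_of_edges {..<n} {{i, Suc i mod n} | i. i < n}"

text \<open>The chair has edges \<open>xy, yz, zt, zv\<close>; here \<open>x, y, z, t, v\<close> are \<open>0, 1, 2, 3, 4\<close>.\<close>

definition chair :: "nat pair_pre_digraph" where
  "chair = graph_of_edges {0, 1, 2, 3, 4} {{0, 1}, {1, 2}, {2, 3}, {2, 4}}"

definition co_chair :: "nat pair_pre_digraph" where
  "co_chair = graph_complement chair"

text \<open>The 3-sun: triangle \<open>0, 1, 2\<close> with the degree-2 vertices \<open>3, 4, 5\<close>.\<close>

definition three_sun :: "nat pair_pre_digraph" where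
  "three_sun = graph_of_edges {0, 1, 2, 3, 4, 5}
     {{0, 1}, {1, 2}, {2, 0}, {3, 0}, {3, 1}, {4, 1}, {4, 2}, {5, 0}, {5, 2}}"


lemma pair_graph_graph_of_edges:
  assumes "finite V" and "\<And>e. e \<in> E \<Longrightarrow> e \<subseteq> V \<and> card e = 2"
  shows "pair_graph (graph_of_edges V E)"
proof -
  have sub: "parcs (graph_of_edges V E) \<subseteq> V \<times> V"
    using assms(2) by (fastforce simp: graph_of_edges_def)
  have ends: "fst e \<in> V" "snd e \<in> V" if "e \<in> parcs (graph_of_edges V E)" for e
    using that sub by auto
  have irr: "fst e \<noteq> snd e" if "e \<in> parcs (graph_of_edges V E)" for e
    using that assms(2) by (fastforce simp: graph_of_edges_def)
  show ?thesis
  proof unfold_locales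
    show "finite (parcs (graph_of_edges V E))"
      using sub assms(1) by (meson finite_SigmaI finite_subset)
    show "symmetric (with_proj (graph_of_edges V E))"
      by (auto simp: symmetric_def sym_def graph_of_edges_def insert_commute)
  qed (use ends irr assms(1) in \<open>simp_all add: graph_of_edges_def\<close>)
qed

lemma pair_graph_complement:
  assumes "pair_graph H"
  shows "pair_graph (graph_complement H)"
proof -
  interpret pair_graph H by fact
  have sub: "parcs (graph_complement H) \<subseteq> pverts H \<times> pverts H"
    by (auto simp: graph_complement_def)
  show ?thesis
  proof unfold_locales
    show "finite (parcs (graph_complement H))"
      using sub pair_finite_verts by (meson finite_SigmaI finite_subset)
    show "symmetric (with_proj (graph_complement H))"
      using pair_sym_arcs by (auto simp: symmetric_def sym_def graph_complement_def)
  qed (auto simp: graph_complement_def pair_finite_verts)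
qed

lemma pair_graph_missing_graph:
  assumes "finite (pverts D)"
  shows "pair_graph (missing_graph D)"
proof -
  have sub: "missing_arcs D \<subseteq> pverts D \<times> pverts D"
    by (auto simp: missing_arcs_def)
  have sub': "{x. \<exists>y. (x, y) \<in> missing_arcs D} \<subseteq> pverts D"
    using sub by auto
  have fin: "finite (missing_arcs D)" "finite {x. \<exists>y. (x, y) \<in> missing_arcs D}"
    using finite_subset[OF sub] finite_subset[OF sub'] assms by auto
  show ?thesis
    by unfold_locales
       (use fin in \<open>auto simp: missing_graph_def symmetric_def sym_def missing_arcs_def\<close>)
qed

end

theory Submission
  imports Defs
begin

text \<open>
  Let \<open>M\<close> be the missing relation. If \<open>a b c d\<close> is an induced path of
  \<open>M\<close> then every other vertex sees both or none of \<open>a, d\<close>, and both or none of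
  \<open>b, c\<close>. A missing edge \<open>ab\<close> loses to a missing edge \<open>cd\<close> if
  \<open>a \<rightarrow> c\<close>, \<open>b \<rightarrow> d\<close>, \<open>d\<close> is not reached from
  \<open>a\<close> and \<open>c\<close> is not reached from \<open>b\<close> in at most two steps; then
  \<open>ab\<close> and \<open>cd\<close> are the end edges of an induced path of \<open>M\<close>. Each
  missing edge loses to at most one missing edge and is beaten by at most one, and going round a cycle of
  the losing relation never reverses an edge (cycles only occur inside an induced pentagon of
  \<open>M\<close>). Hence all missing edges can be oriented consistently along the losing relation,
  starting with a convenient orientation of the edges that are not beaten: one where \<open>x \<rightarrow>
  u\<close> in the digraph implies that \<open>v\<close> is reached from \<open>x\<close> in at most two
  steps, if \<open>uv\<close> is oriented from \<open>u\<close> to \<open>v\<close>. Edges outside the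
  losing relation can be oriented such that this remains true, up to an exception in pentagons, when
  \<open>xu\<close> is itself a missing edge that is oriented towards \<open>u\<close> and loses to some
  other edge.

  Let \<open>f\<close> be the last vertex of a median order of the resulting tournament and turn all missing
  edges at \<open>f\<close> towards \<open>f\<close>, except those oriented \<open>f \<rightarrow> b\<close>
  that lose to another edge. The order keeps its feedback property, so \<open>f\<close> has the second
  neighbourhood property by the argument of Havet and Thomasse. Every kept edge adds one vertex to the first
  neighbourhood of \<open>f\<close>, and on balance at most one to the second.
\<close>

section \<open>Median orders of tournaments\<close>

fun forward_arcs :: "('a \<Rightarrow> 'a \<Rightarrow> bool) \<Rightarrow> 'a list \<Rightarrow> nat" where
  "forward_arcs T [] = 0"
| "forward_arcs T (x # xs) = length (filter (T x) xs) + forward_arcs T xs"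

text \<open>The feedback property of a median order, stated for the last vertex of each interval. In
  this form it passes to suffixes of the list.\<close>

definition feedback :: "('a \<Rightarrow> 'a \<Rightarrow> bool) \<Rightarrow> 'a list \<Rightarrow> bool" where
  "feedback T xs \<longleftrightarrow> (\<forall>ps ys v zs. xs = ps @ ys @ v # zs \<longrightarrow>
     length (filter (T v) ys) \<le> length (filter (\<lambda>y. T y v) ys))"

lemma forward_arcs_move:
  "forward_arcs T (ps @ ys @ v # zs) + length (filter (T v) ys) =
   forward_arcs T (ps @ v # ys @ zs) + length (filter (\<lambda>y. T y v) ys)"
proof (induction ps)
  case Nil
  show ?case by (induction ys) auto
qed auto

lemma feedback_order_exists:
  assumes "finite V"
  shows "\<exists>xs. distinct xs \<and> set xs = V \<and> feedback T xs"
proof -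
  let ?P = "{xs. distinct xs \<and> set xs = V}"
  have fin: "finite ?P"
    by (rule finite_subset[OF _ finite_lists_length_le[OF assms, of "card V"]]) (auto simp: distinct_card)
  have "?P \<noteq> {}" using finite_distinct_list[OF assms] by blast
  then obtain ys where ys: "ys \<in> ?P" by blast
  have "\<forall>zs. zs \<in> ?P \<longrightarrow> forward_arcs T zs < Suc (Max (forward_arcs T ` ?P))"
    using fin by (intro allI impI le_imp_less_Suc Max_ge finite_imageI imageI)
  from ex_has_greatest_nat[of "\<lambda>zs. zs \<in> ?P", OF ys this]
  obtain xs where xs: "xs \<in> ?P"
    and max: "\<And>zs. zs \<in> ?P \<Longrightarrow> forward_arcs T zs \<le> forward_arcs T xs"
    by blast
  \<comment> \<open>If the inequality failed, moving \<open>v\<close> in front of \<open>ys\<close>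
    would increase the number of forward arcs.\<close>
  have "feedback T xs" unfolding feedback_def
  proof (intro allI impI)
    fix ps ys v zs assume e: "xs = ps @ ys @ v # zs"
    have "ps @ v # ys @ zs \<in> ?P" using xs e by auto
    then have "forward_arcs T (ps @ v # ys @ zs) \<le> forward_arcs T xs"
      using max by blast
    then show "length (filter (T v) ys) \<le> length (filter (\<lambda>y. T y v) ys)"
      using forward_arcs_move[of T ps ys v zs] e by simp
  qed
  then show ?thesis using xs by blast
qed

lemma length_filter_mono:
  "(\<And>x. x \<in> set xs \<Longrightarrow> P x \<Longrightarrow> Q x) \<Longrightarrow> length (filter P xs) \<le> length (filter Q xs)"
  by (induction xs) (auto simp: le_SucI)

lemma feedback_suffix: "feedback T (ps @ xs) \<Longrightarrow> feedback T xs"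
  unfolding feedback_def by (metis append.assoc)

text \<open>This is the Havet-Thomasse argument. If some in-neighbour of \<open>f\<close> fails
  \<open>?G\<close>, the list is cut at the first such \<open>v\<close>: the feedback inequality at
  \<open>v\<close> handles the part before it, the induction hypothesis the part after it.\<close>

theorem feed_vertex:
  assumes "feedback T (xs @ [f])" "distinct (xs @ [f])"
    and "\<And>x y. x \<in> set (xs @ [f]) \<Longrightarrow> y \<in> set (xs @ [f]) \<Longrightarrow> x \<noteq> y \<Longrightarrow> T x y \<noteq> T y x"
  shows "length (filter (T f) xs) \<le>
    length (filter (\<lambda>y. T y f \<and> (\<exists>x \<in> set xs. T f x \<and> T x y)) xs)"
  using assms
proof (induction xs rule: length_induct)
  case (1 xs)
  let ?G = "\<lambda>y. T y f \<and> (\<exists>x \<in> set xs. T f x \<and> T x y)"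
  show ?case
  proof (cases "\<exists>v \<in> set xs. T v f \<and> \<not> ?G v")
    case False
    have "length (filter (T f) xs) \<le> length (filter (\<lambda>y. T y f) xs)"
      using 1(2) unfolding feedback_def by (metis append_Nil)
    also have "\<dots> \<le> length (filter ?G xs)" using False by (intro length_filter_mono) blast
    finally show ?thesis .
  next
    case True
    then obtain ys v zs where e: "xs = ys @ v # zs" and v: "T v f" "\<not> ?G v"
      and ys: "\<forall>y \<in> set ys. \<not> (T y f \<and> \<not> ?G y)"
      using split_list_first_prop[of xs "\<lambda>v. T v f \<and> \<not> ?G v"] by blast
    note tour = 1(4)
    have 2: "length (filter (T f) ys) \<le> length (filter (T v) ys)"
    proof (rule length_filter_mono)
      fix y assume y: "y \<in> set ys" "T f y"
      \<comment> \<open>If \<open>y\<close> beat \<open>v\<close>, the route \<open>f\<close>,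
        \<open>y\<close>, \<open>v\<close> would make \<open>v\<close> satisfy
        \<open>?G\<close>.\<close>
      then have "\<not> T y v" using v e by auto
      moreover have "v \<noteq> y" using y 1(3) e by auto
      ultimately show "T v y" using tour[of v y] y(1) e by simp
    qed
    have 3: "\<dots> \<le> length (filter (\<lambda>y. T y v) ys)"
      using 1(2)[unfolded feedback_def, rule_format, of "[]" ys v "zs @ [f]"] e by simp
    have 4: "\<dots> \<le> length (filter ?G ys)"
    proof (rule length_filter_mono)
      fix y assume y: "y \<in> set ys" "T y v"
      have "\<not> T f y" using v y e by auto
      then have "T y f" using tour[of y f] y(1) 1(3) e by fastforce
      then show "?G y" using ys y by blast
    qed
    have "length (filter (T f) zs) \<le> length (filter (\<lambda>y. T y f \<and> (\<exists>x \<in> set zs. T f x \<and> T x y)) zs)"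
    proof (rule 1(1)[rule_format])
      show "length zs < length xs" using e by simp
      show "feedback T (zs @ [f])" using feedback_suffix[of T "ys @ [v]" "zs @ [f]"] 1(2) e by simp
      show "distinct (zs @ [f])" using 1(3) e by auto
      show "T x y \<noteq> T y x" if "x \<in> set (zs @ [f])" "y \<in> set (zs @ [f])" "x \<noteq> y" for x y
        by (rule tour) (use that e in auto)
    qed
    also have "\<dots> \<le> length (filter ?G zs)" using e by (intro length_filter_mono) auto
    finally have 5: "length (filter (T f) zs) \<le> length (filter ?G zs)" .
    have "\<not> T f v" using v(1) tour[of v f] 1(3) e by fastforce
    then have "length (filter (T f) xs) = length (filter (T f) ys) + length (filter (T f) zs)"
      using e by simp
    moreover have "length (filter G ys) + length (filter G zs) \<le> length (filter G xs)" for G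
      by (simp add: e)
    note this[of ?G]
    ultimately show ?thesis using 2 3 4 5 by linarith
  qed
qed

text \<open>Intervals ending before \<open>f\<close> do not see the change; at \<open>f\<close>
  itself the number of in-arcs can only grow and the number of out-arcs only shrink.\<close>

lemma feedback_change_last:
  assumes "feedback T (xs @ [f])"
    and "\<And>x y. x \<in> set xs \<Longrightarrow> y \<in> set xs \<Longrightarrow> T' x y = T x y"
    and "\<And>x. x \<in> set xs \<Longrightarrow> T' f x \<Longrightarrow> T f x" "\<And>x. x \<in> set xs \<Longrightarrow> T x f \<Longrightarrow> T' x f"
  shows "feedback T' (xs @ [f])"
  unfolding feedback_def
proof (intro allI impI)
  fix ps ys v zs assume e: "xs @ [f] = ps @ ys @ v # zs"
  then have f: "length (filter (T v) ys) \<le> length (filter (\<lambda>y. T y v) ys)"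
    using assms(1) unfolding feedback_def by blast
  show "length (filter (T' v) ys) \<le> length (filter (\<lambda>y. T' y v) ys)"
  proof (cases zs rule: rev_cases)
    case Nil
    then have "v = f" "xs = ps @ ys" using e by (auto simp flip: append_assoc)
    then have "length (filter (T' v) ys) \<le> length (filter (T v) ys)"
      "length (filter (\<lambda>y. T y v) ys) \<le> length (filter (\<lambda>y. T' y v) ys)"
      using assms(3,4) by (auto intro!: length_filter_mono)
    then show ?thesis using f by simp
  next
    case (snoc us u)
    then have "xs = ps @ ys @ v # us" using e by (auto simp flip: append_assoc append_Cons)
    then have "filter (T' v) ys = filter (T v) ys" "filter (\<lambda>y. T' y v) ys = filter (\<lambda>y. T y v) ys"
      using assms(2) by (auto intro!: filter_cong)
    then show ?thesis using f by simp
  qed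
qed

section \<open>Induced paths on four vertices in the missing graph\<close>

locale forbidden_free =
  fixes M :: "'a \<Rightarrow> 'a \<Rightarrow> bool"
  assumes sym: "M x y \<Longrightarrow> M y x" and irrefl: "\<not> M x x"
    and no_C4: "\<lbrakk>M a b; M b c; M c d; M d a; a \<noteq> c; b \<noteq> d\<rbrakk> \<Longrightarrow> M a c \<or> M b d"
    and no_2K2: "\<lbrakk>M a b; M c d\<rbrakk> \<Longrightarrow> M a c \<or> M a d \<or> M b c \<or> M b d"
    and no_chair: "\<lbrakk>M x y; M y z; M z t; M z v; t \<noteq> v\<rbrakk>
      \<Longrightarrow> M x z \<or> M x t \<or> M x v \<or> M y t \<or> M y v \<or> M t v"
    and no_co_chair: "\<lbrakk>M x t; M x v; M t v; M y t; M y v; M x z; x \<noteq> y\<rbrakk>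
      \<Longrightarrow> M x y \<or> M y z \<or> M z t \<or> M z v"
    and no_sun: "\<lbrakk>M a b; M b c; M c a; M p a; M p b; M q b; M q c; M r a; M r c\<rbrakk>
      \<Longrightarrow> M p c \<or> M q a \<or> M r b \<or> M p q \<or> M q r \<or> M p r \<or> p = c \<or> q = a \<or> r = b"
begin

definition P4 :: "'a \<Rightarrow> 'a \<Rightarrow> 'a \<Rightarrow> 'a \<Rightarrow> bool" where
  "P4 a b c d \<longleftrightarrow> M a b \<and> M b c \<and> M c d \<and> \<not> M a c \<and> \<not> M b d \<and> \<not> M a d \<and> a \<noteq> c \<and> b \<noteq> d \<and> a \<noteq> d"

lemma P4_rev: "P4 a b c d \<Longrightarrow> P4 d c b a"
  unfolding P4_def using sym by blast

text \<open>For \<open>v\<close> seeing \<open>a\<close> but not \<open>d\<close>, its adjacency to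
  \<open>b\<close> and \<open>c\<close> decides the obstruction: both give a co-chair,
  \<open>c\<close> alone a 4-cycle, and without \<open>c\<close> the edges \<open>v a\<close> and
  \<open>c d\<close> are independent.\<close>

lemma P4_end:
  assumes p: "P4 a b c d" and v: "v \<noteq> a" "v \<noteq> b" "v \<noteq> c" "v \<noteq> d" and va: "M v a"
  shows "M v d"
proof (rule ccontr)
  assume n: "\<not> M v d"
  show False
  proof (cases "M v c")
    case True
    show False
    proof (cases "M v b")
      case True
      show False using p v va n True \<open>M v c\<close> no_co_chair[of c b v a d] unfolding P4_def
        by (smt (verit) sym)
    next
      case False
      show False using p v va n False \<open>M v c\<close> no_C4[of a b c v] unfolding P4_def by (metis sym)
    qed
  next
    case False
    then show False using p v va n no_2K2[of a v c d] unfolding P4_def by (metis sym)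
  qed
qed

text \<open>Let \<open>v\<close> see \<open>b\<close> but not \<open>c\<close>. If it sees
  \<open>a\<close>, hence also \<open>d\<close>, then \<open>v b c d\<close> is a 4-cycle; otherwise
  there is a chair with centre \<open>b\<close>.\<close>

lemma P4_middle:
  assumes p: "P4 a b c d" and v: "v \<noteq> a" "v \<noteq> b" "v \<noteq> c" "v \<noteq> d" and vb: "M v b"
  shows "M v c"
proof (rule ccontr)
  assume n: "\<not> M v c"
  show False
  proof (cases "M v a")
    case True
    then have "M v d" using P4_end[OF p v] by blast
    then show False using p v vb n no_C4[of v b c d] unfolding P4_def by (metis sym)
  next
    case False
    then have "\<not> M v d" using P4_end[OF P4_rev[OF p]] v by blast
    then show False using p v vb n False no_chair[of d c b a v] unfolding P4_def by (metis sym)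
  qed
qed

lemma P4_ends_iff: "P4 a b c d \<Longrightarrow> v \<noteq> a \<Longrightarrow> v \<noteq> b \<Longrightarrow> v \<noteq> c \<Longrightarrow> v \<noteq> d \<Longrightarrow> M v a \<longleftrightarrow> M v d"
  using P4_end P4_rev by metis

lemma P4_middles_iff: "P4 a b c d \<Longrightarrow> v \<noteq> a \<Longrightarrow> v \<noteq> b \<Longrightarrow> v \<noteq> c \<Longrightarrow> v \<noteq> d \<Longrightarrow> M v b \<longleftrightarrow> M v c"
  using P4_middle P4_rev by metis

text \<open>Here \<open>w\<close> sees the whole path and \<open>v\<close> only its middle. If they
  were not adjacent, the triangle \<open>b c w\<close> with \<open>v\<close>, \<open>d\<close>,
  \<open>a\<close> attached would be a 3-sun.\<close>

lemma P4_sun: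
  assumes p: "P4 a b c d" and v: "M v b" "M v c" "\<not> M v a" and w: "M w a" "M w b"
  shows "M v w"
proof (rule ccontr)
  assume n: "\<not> M v w"
  have w': "w \<noteq> a" "w \<noteq> b" "w \<noteq> c" "w \<noteq> d" using p w irrefl sym
    unfolding P4_def by metis+
  have v': "v \<noteq> a" "v \<noteq> b" "v \<noteq> c" "v \<noteq> d" using p v irrefl sym
    unfolding P4_def by metis+
  have "M w c" "M w d" using P4_ends_iff[OF p w'] P4_middles_iff[OF p w'] w by auto
  moreover have "\<not> M v d" using P4_ends_iff[OF p v'] v by auto
  ultimately show False
    using no_sun[of b c w v d a] p v w v' w' n unfolding P4_def by (metis sym)
qed

lemma P4_dominating:
  assumes p: "P4 a b c d" and v: "M v a" "M v b" and w: "M w a" "M w b" and "v \<noteq> w"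
  shows "M v w"
proof -
  have w': "w \<noteq> a" "w \<noteq> b" "w \<noteq> c" "w \<noteq> d" using p w irrefl sym
    unfolding P4_def by metis+
  have v': "v \<noteq> a" "v \<noteq> b" "v \<noteq> c" "v \<noteq> d" using p v irrefl sym
    unfolding P4_def by metis+
  have "M w d" "M v d" using P4_ends_iff[OF p w'] P4_ends_iff[OF p v'] w v by auto
  then show ?thesis using no_C4[of a v d w] p assms unfolding P4_def by (metis sym)
qed

section \<open>Induced pentagons\<close>

definition C5 :: "'a \<Rightarrow> 'a \<Rightarrow> 'a \<Rightarrow> 'a \<Rightarrow> 'a \<Rightarrow> bool" where
  "C5 a b c d e \<longleftrightarrow> P4 a b c d \<and> M e a \<and> M e d \<and> \<not> M e b \<and> \<not> M e c"

lemma C5I: assumes "P4 a b c d" "M e a" "\<not> M e b" "e \<noteq> b" shows "C5 a b c d e"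
proof -
  have v': "e \<noteq> a" "e \<noteq> b" "e \<noteq> c" "e \<noteq> d" using assms irrefl sym
    unfolding P4_def by metis+
  show ?thesis using assms P4_ends_iff[OF assms(1) v'] P4_middles_iff[OF assms(1) v']
    unfolding C5_def by blast
qed

lemma C5_rotate: "C5 a b c d e \<Longrightarrow> C5 b c d e a"
  unfolding C5_def P4_def by (smt (verit) sym irrefl)

text \<open>A pentagon is a module: the both-or-none rule is applied to the induced paths obtained
  by rotating it.\<close>

lemma C5_uniform:
  assumes "C5 a b c d e" "v \<notin> {a,b,c,d,e}"
  shows "M v a \<longleftrightarrow> M v b" "M v b \<longleftrightarrow> M v c" "M v c \<longleftrightarrow> M v d" "M v d \<longleftrightarrow> M v e"
proof -
  have 1: "P4 a b c d" "P4 b c d e" "P4 c d e a" "P4 d e a b"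
    using assms(1) C5_rotate[OF assms(1)] C5_rotate[OF C5_rotate[OF assms(1)]] C5_rotate[OF C5_rotate[OF C5_rotate[OF assms(1)]]]
    unfolding C5_def by blast+
  note e = P4_ends_iff P4_middles_iff
  show "M v a \<longleftrightarrow> M v b" "M v b \<longleftrightarrow> M v c" "M v c \<longleftrightarrow> M v d" "M v d \<longleftrightarrow> M v e"
    using e[OF 1(1), of v] e[OF 1(2), of v] e[OF 1(3), of v] e[OF 1(4), of v] assms(2) by simp_all
qed

lemma P4_C5_uniform:
  assumes "P4 a b c d" "M y a" "\<not> M y b" "y \<noteq> b" "v \<noteq> a" "v \<noteq> b" "v \<noteq> c" "v \<noteq> d" "v \<noteq> y"
  shows "M v a \<longleftrightarrow> M v y" "M v b \<longleftrightarrow> M v y"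
  using C5_uniform[OF C5I[OF assms(1-4)], of v] assms(5-) by auto

lemma P4_D:
  assumes "P4 a b c d"
  shows "M a b" "M b a" "M b c" "M c b" "M c d" "M d c"
    "\<not> M a c" "\<not> M c a" "\<not> M b d" "\<not> M d b" "\<not> M a d" "\<not> M d a" "a \<noteq> b" "a \<noteq> c" "a \<noteq> d" "b \<noteq> c" "b \<noteq> d" "c \<noteq> d"
  using assms irrefl sym unfolding P4_def by blast+

lemmas P4_rules = P4_ends_iff P4_middles_iff P4_sun P4_dominating P4_C5_uniform

lemma C5_rev: "C5 a b c d e \<Longrightarrow> C5 b a e d c"
  unfolding C5_def P4_def by (smt (verit) sym irrefl)

lemma C5_P4_continue:
  assumes "C5 a b c d e" and p: "P4 a b x y"
  shows "x = c \<and> y = d"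
proof -
  note P4_D[OF p]
  moreover have "P4 a b c d" "P4 b c d e" "P4 c d e a"
    using assms(1) C5_rotate[OF assms(1)] C5_rotate[OF C5_rotate[OF assms(1)]] unfolding C5_def by blast+
  note P4_D[OF this(1)] P4_D[OF this(2)] P4_D[OF this(3)]
  moreover note C5_uniform[OF assms(1), of x]  C5_uniform[OF assms(1), of y]
  ultimately show ?thesis by auto
qed

section \<open>Pairs of induced paths with related end edges\<close>

lemma P4_same_start:
  assumes p: "P4 s k k1 s1" and q: "P4 s k k2 s2" and ne: "k1 \<noteq> k2 \<or> s1 \<noteq> s2"
  shows "\<not> M k1 s2 \<and> k1 \<noteq> s2"
  using P4_D[OF p] P4_D[OF q] P4_rules[OF p] P4_rules[OF q] ne by (smt (verit) sym irrefl)

lemma P4_opposite_start: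
  assumes p: "P4 a b c d" and q: "P4 b a x y"
  shows "y = d"
  using P4_D[OF p] P4_D[OF q] P4_rules[OF p] no_2K2[of b c x y] by (smt (verit) sym irrefl)

text \<open>Shortens a chain of teeth to one path between its first and its last edge.\<close>

lemma P4_trans:
  assumes p: "P4 s k k1 s1" and q: "P4 s1 k1 k2 s2" and ne: "s2 \<noteq> s"
  shows "P4 s k k2 s2"
  unfolding P4_def
  using P4_D[OF p] P4_D[OF q] P4_rules[OF p] ne  by (smt (verit) sym irrefl)

text \<open>In both cases \<open>b\<close> and \<open>u\<close> are either the two middles or the
  two ends of the path, so only \<open>a\<close> can see \<open>b\<close> without seeing
  \<open>u\<close>. This identifies an unknown vertex as the partner in a losing edge.\<close>

lemma P4_start_unique:
  assumes "P4 a b u v \<or> P4 b a v u" "M z b" "\<not> M z u" "z \<noteq> u"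
  shows "z = a"
  using assms(1)
proof
  assume p: "P4 a b u v"
  show ?thesis using P4_D[OF p] P4_middles_iff[OF p, of z] assms(2-) sym irrefl by blast
next
  assume p: "P4 b a v u"
  show ?thesis using P4_D[OF p] P4_ends_iff[OF p, of z] assms(2-) sym irrefl by blast
qed

lemma C5_unique: assumes "C5 a b c d e" "C5 a b c d e'" shows "e = e'"
proof (rule ccontr)
  assume "e \<noteq> e'"
  moreover have "e' \<notin> {a, b, c, d}" using assms(2) irrefl P4_D unfolding C5_def by blast
  ultimately show False using C5_uniform(1)[OF assms(1), of e'] assms(2) unfolding C5_def by blast
qed

text \<open>By \<open>loses_P4\<close> below, \<open>P4 x u c d \<or> P4 u x d c\<close> holds whenever \<open>xu\<close> loses to \<open>cd\<close>.\<close>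

lemma adjacent_end_edges:
  assumes "P4 f b c d \<or> P4 b f d c" "P4 b v x y \<or> P4 v b x y" "v \<noteq> f" "v \<noteq> c"
  shows "C5 b f d c v"
proof -
  have 1: False if p: "P4 f b c d" and q: "P4 b v x y"
    using P4_rules[OF p] P4_rules[OF q] P4_D[OF p] P4_D[OF q] assms(3,4) no_2K2[of b c x y]
    by (smt (verit) sym irrefl)
  have 2: False if p: "P4 f b c d" and q: "P4 v b x y"
    using P4_rules[OF p] P4_rules[OF q] P4_D[OF p] P4_D[OF q] assms(3,4) no_2K2[of b c x y]
    by (smt (verit) sym irrefl)
  have 3: "C5 b f d c v" if p: "P4 b f d c" and q: "P4 v b x y"
    using P4_rules[OF p] P4_rules[OF q] P4_D[OF p] P4_D[OF q] assms(3) no_2K2[of b c x y] C5I[OF p]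
    by (smt (verit) sym irrefl)
  have 4: "C5 b f d c v" if p: "P4 b f d c" and q: "P4 b v x y"
    using P4_rules[OF p] P4_rules[OF q] P4_D[OF p] P4_D[OF q] assms(3) no_2K2[of f d x y] C5I[OF p]
    by (smt (verit) sym irrefl)
  show ?thesis using assms(1,2) 1 2 3 4 by blast
qed

text \<open>This lemma and the next three serve edges \<open>u v\<close> outside the losing
  relation. The vertices \<open>x\<close> and \<open>y\<close>, possibly equal, will obstruct
  convenience in the two directions; each configuration is impossible or closes up to a
  pentagon.\<close>

lemma end_edge_extension_path:
  assumes "P4 x u c d \<or> P4 u x d c"
    and e: "M u v" "v \<noteq> x" "v \<noteq> c" "M x y" "\<not> M y v" "y \<noteq> v"
  shows "C5 u x d c v"
proof -
  have 1: False if p: "P4 x u c d"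
    using P4_rules[OF p] P4_D[OF p] e by (smt (verit) sym irrefl)
  have 2: "C5 u x d c v" if p: "P4 u x d c"
    using P4_rules[OF p] P4_D[OF p] e C5I[OF p] by (smt (verit) sym irrefl)
  show ?thesis using assms(1) 1 2 by blast
qed

lemma no_triangle_of_end_edges:
  assumes "P4 x u c d \<or> P4 u x d c" "P4 x v c' d' \<or> P4 v x d' c'" "M u v"
  shows False
proof -
  have 1: False if p: "P4 x u c d" and q: "P4 x v c' d'"
    using P4_rules[OF p] P4_D[OF p] P4_rules[OF q] P4_D[OF q] assms(3) by (smt (verit) sym irrefl)
  have 2: False if p: "P4 x u c d" and q: "P4 v x d' c'" and m: "M u v" for u v c d c' d'
    using P4_rules[OF p] P4_D[OF p] P4_rules[OF q] P4_D[OF q] m by (smt (verit) sym irrefl)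
  have 3: False if p: "P4 u x d c" and q: "P4 v x d' c'"
    using P4_rules[OF p] P4_D[OF p] P4_rules[OF q] P4_D[OF q] assms(3) by (smt (verit) sym irrefl)
  show False using assms(1,2) 1 2[of u c d v d' c'] 2[of v c' d' u d c] 3 assms(3) sym[OF assms(3)] by blast
qed

lemma end_edges_common_vertex:
  assumes "P4 x u c d \<or> P4 u x d c" "P4 x b y v \<or> P4 b x v y"
    and m: "M u v" "b \<noteq> u" "v \<noteq> c"
  shows "C5 u x d c v"
proof -
  have 1: False if p: "P4 x u c d" and q: "P4 x b y v"
    using P4_rules[OF p] P4_D[OF p] P4_rules[OF q] P4_D[OF q] m by (smt (verit) sym irrefl)
  have 2: False if p: "P4 x u c d" and q: "P4 b x v y"
    using P4_rules[OF p] P4_D[OF p] P4_rules[OF q] P4_D[OF q] m by (smt (verit) sym irrefl)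
  have 3: "C5 u x d c v" if p: "P4 u x d c" and q: "P4 x b y v"
    using P4_rules[OF p] P4_D[OF p] P4_rules[OF q] P4_D[OF q] m C5I[OF p] by (smt (verit) sym irrefl)
  have 4: "C5 u x d c v" if p: "P4 u x d c" and q: "P4 b x v y"
    using P4_rules[OF p] P4_D[OF p] P4_rules[OF q] P4_D[OF q] m C5I[OF p] by (smt (verit) sym irrefl)
  show ?thesis using assms(1,2) 1 2 3 4 by blast
qed

lemma no_square_of_end_edges:
  assumes "P4 x u c d \<or> P4 u x d c" "P4 y v c' d' \<or> P4 v y d' c'"
    and m: "M u v" "M x y" "v \<noteq> c" "u \<noteq> c'" "u \<noteq> y" "v \<noteq> x"
  shows False
proof -
  have 1: False if p: "P4 x u c d" and q: "P4 y v c' d'"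
    using P4_rules[OF p] P4_D[OF p] P4_rules[OF q] P4_D[OF q] m by (smt (verit) sym irrefl)
  have 2: False if p: "P4 x u c d" and q: "P4 v y d' c'"
      and m: "M u v" "M x y" "v \<noteq> c" "u \<noteq> c'" "u \<noteq> y" "v \<noteq> x" for x u c d y v c' d'
    using P4_rules[OF p] P4_D[OF p] P4_rules[OF q] P4_D[OF q] m by (smt (verit) sym irrefl)
  have 3: False if p: "P4 u x d c" and q: "P4 v y d' c'"
    using P4_rules[OF p] P4_D[OF p] P4_rules[OF q] P4_D[OF q] m by (smt (verit) sym irrefl)
  show False
    using assms(1,2) 1 2[of x u c d v y d' c'] 2[of y v c' d' u x d c] 3 m sym by blast
qed

end

section \<open>The losing relation on missing edges\<close>

locale oriented_missing = forbidden_free M for M :: "'a \<Rightarrow> 'a \<Rightarrow> bool" +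
  fixes V :: "'a set" and A :: "'a \<Rightarrow> 'a \<Rightarrow> bool"
  assumes fin: "finite V" and A_V: "A x y \<Longrightarrow> x \<in> V \<and> y \<in> V"
    and asym: "A x y \<Longrightarrow> \<not> A y x"
    and M_iff: "M x y \<longleftrightarrow> x \<in> V \<and> y \<in> V \<and> x \<noteq> y \<and> \<not> A x y \<and> \<not> A y x"
begin

definition reach2 where "reach2 x y \<longleftrightarrow> A x y \<or> (\<exists>z. A x z \<and> A z y)"

definition loses where
  "loses a b c d \<longleftrightarrow> M a b \<and> M c d \<and> A a c \<and> A b d \<and> \<not> reach2 a d \<and> \<not> reach2 b c"

text \<open>The names recall the typical case, where \<open>s k\<close> and \<open>s' k'\<close> are teeth of a comb whose spine is a
  clique containing \<open>k\<close>
    and \<open>k'\<close>; in a pentagon the two roles can be interchanged.\<close>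

definition tooth where
  "tooth s k k' s' \<longleftrightarrow> P4 s k k' s' \<and> A k s' \<and> A s' s \<and> A s k' \<and> \<not> reach2 k k' \<and> \<not> reach2 s s'"

lemma reach2_arc: "A x y \<Longrightarrow> reach2 x y"
  and reach2_path: "A x z \<Longrightarrow> A z y \<Longrightarrow> reach2 x y"
  unfolding reach2_def by blast+

lemma M_D: "M x y \<Longrightarrow> x \<in> V \<and> y \<in> V \<and> x \<noteq> y \<and> \<not> A x y \<and> \<not> A y x"
  unfolding M_iff by blast

lemma arc_or_M: "x \<in> V \<Longrightarrow> y \<in> V \<Longrightarrow> x \<noteq> y \<Longrightarrow> M x y \<or> A x y \<or> A y x"
  unfolding M_iff by blast

lemma A_D: "A x y \<Longrightarrow> x \<in> V \<and> y \<in> V \<and> x \<noteq> y \<and> \<not> M x y \<and> \<not> M y x \<and> \<not> A y x"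
  using A_V asym unfolding M_iff by blast

lemma loses_swap: "loses a b c d \<Longrightarrow> loses b a d c"
  unfolding loses_def using sym by blast

text \<open>Since \<open>d\<close> is not reached from \<open>a\<close> nor \<open>c\<close> from
  \<open>b\<close>, each of the pairs \<open>a d\<close> and \<open>b c\<close> is missing or
  carries the backward arc. Independent edges are forbidden, so at least one is missing; 4-cycles
  are forbidden, so not both. The two cases left are the two teeth.\<close>

lemma loses_iff_tooth: "loses a b c d \<longleftrightarrow> tooth a b c d \<or> tooth b a d c"
proof
  assume l: "loses a b c d"
  then have m: "M a b" "M c d" and a: "A a c" "A b d"
    and r: "\<not> reach2 a d" "\<not> reach2 b c" unfolding loses_def by auto
  have n: "a \<noteq> d" "b \<noteq> c" "a \<noteq> c" "b \<noteq> d" "\<not> M a c" "\<not> M b d"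
    using m a M_D A_D by metis+
  have v: "a \<in> V" "b \<in> V" "c \<in> V" "d \<in> V" using m M_D by blast+
  have nr: "\<not> A a d" "\<not> A b c" using r reach2_arc by auto
  have 1: "M a d \<or> A d a" "M b c \<or> A c b" using arc_or_M v n nr by metis+
  have 2: "M a d \<or> M b c" using no_2K2[OF m] n by auto
  have 3: "\<not> (M a d \<and> M b c)" using no_C4[of a b c d] m n sym by blast
  show "tooth a b c d \<or> tooth b a d c"
    using 1 2 3 m a r n nr unfolding tooth_def P4_def by (metis sym)
next
  assume "tooth a b c d \<or> tooth b a d c"
  then show "loses a b c d" unfolding tooth_def P4_def loses_def using sym by blast
qed

lemma loses_P4: "loses a b c d \<Longrightarrow> P4 a b c d \<or> P4 b a d c"
  unfolding loses_iff_tooth tooth_def by blast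

text \<open>Two different paths with the same first edge force an arc between \<open>k1\<close> and
  \<open>s2\<close>. Either direction completes an excluded route: \<open>s\<close>,
  \<open>k1\<close>, \<open>s2\<close> or \<open>k\<close>, \<open>s2\<close>,
  \<open>k1\<close>.\<close>

lemma tooth_det: assumes "tooth s k k1 s1" "tooth s k k2 s2" shows "k1 = k2 \<and> s1 = s2"
proof (rule ccontr)
  assume "\<not> ?thesis"
  then have "\<not> M k1 s2 \<and> k1 \<noteq> s2" using P4_same_start[of s k k1 s1 k2 s2] assms
    unfolding tooth_def by blast
  then have "A k1 s2 \<or> A s2 k1" using arc_or_M assms A_V unfolding tooth_def by blast
  then show False using assms reach2_path unfolding tooth_def by blast
qed

lemma tooth_codet: assumes "tooth s1 k1 k s" "tooth s2 k2 k s" shows "k1 = k2 \<and> s1 = s2"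
proof (rule ccontr)
  assume "\<not> ?thesis"
  then have "\<not> M k2 s1 \<and> k2 \<noteq> s1"
    using P4_same_start[of s k k2 s2 k1 s1] P4_rev assms unfolding tooth_def by blast
  then have "A k2 s1 \<or> A s1 k2" using arc_or_M assms A_V unfolding tooth_def by blast
  then show False using assms reach2_path unfolding tooth_def by blast
qed

text \<open>With the roles of \<open>a\<close> and \<open>b\<close> interchanged both paths would
  end in \<open>d\<close>, and the pair \<open>b d\<close> would be oriented both ways.\<close>

lemma tooth_not_opposite: assumes "tooth a b c d" shows "\<not> tooth b a x y"
proof
  assume q: "tooth b a x y"
  then have "y = d" using P4_opposite_start assms unfolding tooth_def by blast
  then show False using q assms asym unfolding tooth_def by blast
qed

lemma tooth_not_co_opposite: assumes "tooth a b c d" shows "\<not> tooth y x d c"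
proof
  assume q: "tooth y x d c"
  then have "y = a" using P4_opposite_start[of d c b a x y] P4_rev assms unfolding tooth_def by blast
  then show False using q assms asym unfolding tooth_def by blast
qed

lemma loses_det: "loses a b c d \<Longrightarrow> loses a b c' d' \<Longrightarrow> c = c' \<and> d = d'"
  unfolding loses_iff_tooth using tooth_det tooth_not_opposite by blast

lemma loses_codet: "loses a b c d \<Longrightarrow> loses a' b' c d \<Longrightarrow> a = a' \<and> b = b'"
  unfolding loses_iff_tooth using tooth_codet tooth_not_co_opposite by blast

section \<open>Following the losing relation never reverses an edge\<close>

definition tooth_rel where "tooth_rel = {((s, k), (s', k')). tooth s k k' s'}"
definition losing where "losing = {((a, b), (c, d)). loses a b c d}"

text \<open>An arc from the first outer vertex to the last would continue to the second outer
  vertex, a route that the first tooth excludes; so the closing arc points backward along the whole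
  chain.\<close>

lemma tooth_chain: "(p, q) \<in> tooth_rel\<^sup>+ \<Longrightarrow> P4 (fst p) (snd p) (snd q) (fst q) \<and> A (fst q) (fst p)"
proof (induction rule: converse_trancl_induct)
  case (base p)
  then show ?case unfolding tooth_rel_def tooth_def by auto
next
  case (step p z)
  then have q: "tooth (fst p) (snd p) (snd z) (fst z)" unfolding tooth_rel_def by auto
  have ne: "fst q \<noteq> fst p" using q step.IH asym unfolding tooth_def by metis
  have p4: "P4 (fst p) (snd p) (snd q) (fst q)"
    using P4_trans[OF _ _ ne] q step.IH unfolding tooth_def by blast
  have "\<not> A (fst p) (fst q)" using q step.IH reach2_path unfolding tooth_def by blast
  then have "A (fst q) (fst p)" using p4 arc_or_M[of "fst p" "fst q"] ne q step.IH A_V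
    unfolding tooth_def P4_def by metis
  then show ?case using p4 by blast
qed

definition rotation where "rotation a b c d e = {(a, b), (b, c), (c, d), (d, e), (e, a)}"

text \<open>Both continuations stay in the pentagon and keep the cyclic direction, which makes
  \<open>rotation\<close> closed under \<open>losing\<close>.\<close>

lemma C5_loses_next:
  assumes "C5 a b c d e" "loses a b x y" shows "(x, y) = (c, d) \<or> (x, y) = (d, e)"
  using assms(2) C5_P4_continue[OF assms(1), of x y] C5_P4_continue[OF C5_rev[OF assms(1)], of y x] loses_P4
  by blast

lemma rotation_closed:
  assumes c: "C5 a b c d e" and "p \<in> rotation a b c d e" "(p, q) \<in> losing"
  shows "q \<in> rotation a b c d e"
proof -
  note c2 = C5_rotate[OF c] note c3 = C5_rotate[OF c2] note c4 = C5_rotate[OF c3] note c5 = C5_rotate[OF c4]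
  obtain x y where q: "q = (x, y)" by (cases q)
  have "(x, y) \<in> rotation a b c d e"
    if "loses a b x y \<or> loses b c x y \<or> loses c d x y \<or> loses d e x y \<or> loses e a x y"
    using that C5_loses_next[OF c, of x y] C5_loses_next[OF c2, of x y] C5_loses_next[OF c3, of x y]
      C5_loses_next[OF c4, of x y] C5_loses_next[OF c5, of x y] unfolding rotation_def by blast
  then show ?thesis using assms(2,3) q unfolding rotation_def losing_def by blast
qed

lemma rotation_swap: assumes c: "C5 a b c d e" "p \<in> rotation a b c d e"
  shows "prod.swap p \<notin> rotation a b c d e"
proof -
  have "P4 a b c d" "P4 b c d e" "P4 c d e a"
    using c(1) C5_rotate[OF c(1)] C5_rotate[OF C5_rotate[OF c(1)]] unfolding C5_def by blast+
  note P4_D[OF this(1)] P4_D[OF this(2)] P4_D[OF this(3)]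
  then show ?thesis using c(2) unfolding rotation_def by auto
qed

lemma rotation_no_flip:
  assumes c: "C5 a b c d e" "p \<in> rotation a b c d e" shows "(p, prod.swap p) \<notin> losing\<^sup>+"
proof
  assume "(p, prod.swap p) \<in> losing\<^sup>+"
  then have "prod.swap p \<in> rotation a b c d e"
  proof (induction rule: trancl_induct)
    case (base y) then show ?case using rotation_closed c by blast
  next
    case (step y z) then show ?case using rotation_closed c by blast
  qed
  then show False using rotation_swap c by blast
qed

lemma losing_swap: "(p, q) \<in> losing \<Longrightarrow> (prod.swap p, prod.swap q) \<in> losing"
  unfolding losing_def using loses_swap by auto

lemma losing_single_valued: "single_valued losing" "single_valued (losing\<inverse>)"
  unfolding single_valued_def losing_def using loses_det loses_codet by auto

lemma flip_next:
  assumes "(p, prod.swap p) \<in> losing\<^sup>+" "(p, q) \<in> losing"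
    shows "(q, prod.swap q) \<in> losing\<^sup>+"
proof -
  obtain z where "(p, z) \<in> losing" "(z, prod.swap p) \<in> losing\<^sup>*"
    using tranclD[OF assms(1)] by blast
  then have "(q, prod.swap p) \<in> losing\<^sup>*" using losing_single_valued(1) assms(2)
    unfolding single_valued_def by blast
  then show ?thesis using losing_swap[OF assms(2)] by (rule rtrancl_into_trancl1)
qed

lemma losing_tooth_rel: assumes "(p, q) \<in> losing"
  shows "\<exists>p' \<in> {p, prod.swap p}. \<exists>q' \<in> {q, prod.swap q}. (p', q') \<in> tooth_rel"
  using assms unfolding losing_def tooth_rel_def loses_iff_tooth by auto

text \<open>If the ends of \<open>r\<close> exchange the roles of outer and spine vertex between
  consecutive teeth, the vertex \<open>x\<close> closes the first path to a pentagon, where no edge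
  is reversed.\<close>

lemma tooth_twist:
  assumes "(z, r) \<in> tooth_rel" "(prod.swap r, t) \<in> tooth_rel"
  shows "(r, prod.swap r) \<notin> losing\<^sup>+" "(prod.swap r, r) \<notin> losing\<^sup>+"
proof -
  obtain s k s' k' where r: "r = (s', k')" and z: "z = (s, k)" by (cases r, cases z)
  obtain y x where t: "t = (y, x)" by (cases t)
  have "tooth s k k' s'" "tooth k' s' x y" using assms r z t unfolding tooth_rel_def by auto
  then have "C5 s' k' k s x" using C5I[OF P4_rev] P4_D unfolding tooth_def by metis
  note c = this C5_rev[OF this]
  then show "(r, prod.swap r) \<notin> losing\<^sup>+" "(prod.swap r, r) \<notin> losing\<^sup>+"
    using rotation_no_flip[OF c(1), of r] rotation_no_flip[OF c(2), of "prod.swap r"] r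
      unfolding rotation_def by auto
qed

text \<open>Under the assumption of a reversal, \<open>tooth_twist\<close> rules out every exchange
  of roles, so the teeth fit together into one chain of \<open>tooth_rel\<close>.\<close>

lemma flip_chain:
  assumes "(p, r) \<in> losing\<^sup>+" "(p, prod.swap p) \<in> losing\<^sup>+"
  shows "(r, prod.swap r) \<in> losing\<^sup>+ \<and>
    (\<exists>p' \<in> {p, prod.swap p}. \<exists>r' \<in> {r, prod.swap r}. (p', r') \<in> tooth_rel\<^sup>+)"
  using assms
proof (induction rule: trancl_induct)
  case (base r)
  then show ?case using losing_tooth_rel flip_next by blast
next
  case (step r t)
  then obtain p' r' where 1: "(r, prod.swap r) \<in> losing\<^sup>+" "p' \<in> {p, prod.swap p}" "r' \<in> {r, prod.swap r}"
     "(p', r') \<in> tooth_rel\<^sup>+" by blast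
  obtain r'' t' where 2: "r'' \<in> {r, prod.swap r}" "t' \<in> {t, prod.swap t}" "(r'', t') \<in> tooth_rel"
    using losing_tooth_rel[OF step.hyps(2)] by blast
  obtain z where z: "(z, r') \<in> tooth_rel" using tranclD2[OF 1(4)] by blast
  have "r'' = r'"
  proof (rule ccontr)
    assume "r'' \<noteq> r'"
    then have "r'' = prod.swap r'" using 1(3) 2(1) by auto
    then show False using tooth_twist[OF z, of t'] 2(3) 1(1,3) by auto
  qed
  then have "(p', t') \<in> tooth_rel\<^sup>+" using 1(4) 2(3) by auto
  then show ?case using flip_next[OF 1(1) step.hyps(2)] 1(2) 2(2) by blast
qed

text \<open>A reversal would give a chain of teeth whose first and last edge have the same ends,
  while \<open>tooth_chain\<close> yields a path on four distinct vertices.\<close>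

lemma no_flip: "(p, prod.swap p) \<notin> losing\<^sup>+"
proof
  assume a: "(p, prod.swap p) \<in> losing\<^sup>+"
  obtain p' r' where "p' \<in> {p, prod.swap p}" "r' \<in> {p, prod.swap p}" "(p', r') \<in> tooth_rel\<^sup>+"
    using flip_chain[OF a a] unfolding swap_swap by blast
  then show False using tooth_chain[of p' r'] unfolding P4_def by auto
qed

section \<open>Orienting the missing edges\<close>

definition convenient where "convenient u v \<longleftrightarrow> (\<forall>x. A x u \<longrightarrow> reach2 x v)"

text \<open>An arc between \<open>x\<close> and \<open>y\<close> would complete a two-step route to
  \<open>v\<close> or to \<open>u\<close>. Consequently an unbeaten missing edge is convenient in at
  least one direction.\<close>

lemma losesI:
  assumes "M u v" "A x u" "\<not> reach2 x v" "A y v" "\<not> reach2 y u"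
  shows "loses x y u v"
proof -
  have "\<not> A x y" "\<not> A y x" "x \<noteq> y" using assms reach2_arc reach2_path by blast+
  then have "M x y" using arc_or_M A_V assms by blast
  then show ?thesis using assms unfolding loses_def by blast
qed

definition coherent where "coherent X \<longleftrightarrow> (\<forall>a b. (a, b) \<in> X \<longrightarrow> M a b \<and> (b, a) \<notin> X)
  \<and> (\<forall>p q. (p, q) \<in> losing \<longrightarrow> (p \<in> X \<longleftrightarrow> q \<in> X))
  \<and> (\<forall>a b. (a, b) \<in> X \<longrightarrow> (\<forall>p. (p, (a, b)) \<notin> losing) \<longrightarrow> convenient a b)"

text \<open>As \<open>losing\<close> is single-valued both ways, this is the whole component of
  \<open>p\<close>, a path or a cycle.\<close>

definition chain where "chain p = {q. (p, q) \<in> losing\<^sup>* \<or> (q, p) \<in> losing\<^sup>*}"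

lemma losing_forward: assumes "(p, q) \<in> losing" "(p, r) \<in> losing\<^sup>*"
  shows "r = p \<or> (q, r) \<in> losing\<^sup>*"
  using assms losing_single_valued(1) unfolding single_valued_def by (metis converse_rtranclE)

lemma losing_backward: assumes "(q, p) \<in> losing" "(r, p) \<in> losing\<^sup>*"
  shows "r = p \<or> (r, q) \<in> losing\<^sup>*"
  using assms losing_single_valued(2) unfolding single_valued_def by (metis rtranclE converse_iff)

lemma chain_closed: assumes "(q, r) \<in> losing"
  shows "q \<in> chain p \<longleftrightarrow> r \<in> chain p"
  using assms losing_forward[OF assms, of p] losing_backward[OF assms, of p] unfolding chain_def
  by (auto intro: rtrancl_into_rtrancl converse_rtrancl_into_rtrancl)

lemma losing_comparable:
  assumes "(p, q) \<in> losing\<^sup>* \<or> (q, p) \<in> losing\<^sup>*" "(p, r) \<in> losing\<^sup>* \<or> (r, p) \<in> losing\<^sup>*"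
  shows "(q, r) \<in> losing\<^sup>* \<or> (r, q) \<in> losing\<^sup>*"
  using assms single_valued_confluent[OF losing_single_valued(1), of p q r] single_valued_confluent[OF losing_single_valued(2), of p q r]
  unfolding rtrancl_converse by (auto intro: rtrancl_trans)

lemma chain_swap: "q \<in> chain p \<Longrightarrow> prod.swap q \<in> chain (prod.swap p)"
proof -
  have "(a, b) \<in> losing\<^sup>* \<Longrightarrow> (prod.swap a, prod.swap b) \<in> losing\<^sup>*" for a b
    by (induction rule: rtrancl_induct) (auto intro: rtrancl_into_rtrancl losing_swap)
  then show "q \<in> chain p \<Longrightarrow> prod.swap q \<in> chain (prod.swap p)"
    unfolding chain_def by blast
qed

lemma chain_antisym:
  assumes "q \<in> chain p" "fst q \<noteq> snd q" shows "prod.swap q \<notin> chain p"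
proof
  assume "prod.swap q \<in> chain p"
  then have "(q, prod.swap q) \<in> losing\<^sup>* \<or> (prod.swap q, q) \<in> losing\<^sup>*"
    using losing_comparable assms unfolding chain_def by blast
  moreover have "q \<noteq> prod.swap q" using assms(2) by (metis fst_swap)
  ultimately have "(q, prod.swap q) \<in> losing\<^sup>+ \<or> (prod.swap q, prod.swap (prod.swap q)) \<in> losing\<^sup>+"
    by (auto simp: rtrancl_eq_or_trancl)
  then show False using no_flip by blast
qed

lemma chain_missing: assumes "q \<in> chain p" "M (fst p) (snd p)" shows "M (fst q) (snd q)"
proof -
  have "(p, q) \<in> losing \<Longrightarrow> M (fst p) (snd p) \<and> M (fst q) (snd q)" for p q
    unfolding losing_def loses_def by auto
  then show ?thesis using assms unfolding chain_def by (auto elim: rtranclE converse_rtranclE)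
qed

lemma root_unique:
  assumes "r \<in> chain p" "r' \<in> chain p" "\<And>q. (q, r) \<notin> losing" "\<And>q. (q, r') \<notin> losing"
  shows "r = r'"
  using losing_comparable[of p r r'] assms unfolding chain_def by (auto elim: rtranclE)

lemma coherent_chain:
  assumes "M (fst p) (snd p)"
    and "\<And>r. r \<in> chain p \<Longrightarrow> (\<And>q. (q, r) \<notin> losing) \<Longrightarrow> convenient (fst r) (snd r)"
  shows "coherent (chain p)"
proof -
  have "M a b \<and> (b, a) \<notin> chain p" if "(a, b) \<in> chain p" for a b
    using chain_missing[OF that assms(1)] chain_antisym[OF that] M_D by auto
  then show ?thesis unfolding coherent_def using chain_closed assms(2) by fastforce
qed

text \<open>If the reversed chain has an inconvenient root, \<open>losesI\<close> makes the reversal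
  of that root convenient, and this reversal is the only possible root of
  \<open>chain p\<close>.\<close>

lemma coherent_chain_or_swap:
  assumes "M (fst p) (snd p)"
  shows "coherent (chain p) \<or> coherent (chain (prod.swap p))"
proof (rule disjCI)
  assume "\<not> coherent (chain (prod.swap p))"
  then obtain r where r: "r \<in> chain (prod.swap p)" "\<And>q. (q, r) \<notin> losing" "\<not> convenient (fst r) (snd r)"
    using coherent_chain[of "prod.swap p"] assms sym by auto
  have m: "M (fst r) (snd r)" using chain_missing[OF r(1)] assms sym by auto
  have "\<not> loses x y (fst r) (snd r)" for x y using r(2)[of "(x, y)"] unfolding losing_def by auto
  then have c: "convenient (snd r) (fst r)"
    using r(3) losesI[OF m] unfolding convenient_def by blast
  show "coherent (chain p)"
  proof (rule coherent_chain[OF assms])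
    fix r' assume r': "r' \<in> chain p" "\<And>q. (q, r') \<notin> losing"
    have "\<And>q. (q, prod.swap r') \<notin> losing" using r'(2) losing_swap by fastforce
    then have "r = prod.swap r'" using root_unique[OF r(1) chain_swap[OF r'(1)] r(2)] by blast
    then show "convenient (fst r') (snd r')" using c by simp
  qed
qed

lemma coherent_extend:
  assumes o: "coherent X" "coherent (chain p)" and "p \<notin> X" "prod.swap p \<notin> X"
  shows "coherent (X \<union> chain p)"
proof -
  have chain: "(a, b) \<in> losing\<^sup>* \<Longrightarrow> a \<in> X \<longleftrightarrow> b \<in> X" for a b
    by (induction rule: rtrancl_induct) (use o(1) in \<open>auto simp: coherent_def\<close>)
  have d: "q \<notin> X" if "q \<in> chain p" for q using that chain assms(3) unfolding chain_def by blast
  have d': "prod.swap q \<notin> X" if "q \<in> chain p" for q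
    using chain_swap[OF that] chain assms(4) unfolding chain_def by blast
  have "M a b \<and> (b, a) \<notin> X \<union> chain p" if "(a, b) \<in> X \<union> chain p" for a b
    using that o d'[of "(a,b)"] d'[of "(b,a)"] unfolding coherent_def by auto
  then show ?thesis using o unfolding coherent_def by blast
qed

lemma coherent_exists: "\<exists>X. coherent X \<and> (\<forall>a b. M a b \<longrightarrow> (a, b) \<in> X \<or> (b, a) \<in> X)"
proof -
  have "\<exists>X. coherent X \<and> (\<forall>p \<in> F. p \<in> X \<or> prod.swap p \<in> X)"
    if "finite F" "\<forall>p \<in> F. M (fst p) (snd p)" for F
    using that
  proof (induction F rule: finite_induct)
    case empty
    show ?case by (rule exI[of _ "{}"]) (simp add: coherent_def)
  next
    case (insert p F)
    then obtain X where o: "coherent X" "\<forall>p \<in> F. p \<in> X \<or> prod.swap p \<in> X" by auto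
    show ?case
    proof (cases "p \<in> X \<or> prod.swap p \<in> X")
      case True then show ?thesis using o by auto
    next
      case False
      have pc: "q \<in> chain q" for q unfolding chain_def by simp
      consider "coherent (X \<union> chain p)" | "coherent (X \<union> chain (prod.swap p))"
        using coherent_extend[OF o(1), of p] coherent_extend[OF o(1), of "prod.swap p"] coherent_chain_or_swap[of p] insert.prems False
        by auto
      then show ?thesis
      proof cases
        case 1 then show ?thesis using o(2) pc[of p] by (intro exI[of _ "X \<union> chain p"]) auto
      next
        case 2 then show ?thesis using o(2) pc[of "prod.swap p"]
          by (intro exI[of _ "X \<union> chain (prod.swap p)"]) auto
      qed
    qed
  qed
  moreover have "finite {p. M (fst p) (snd p)}"
    by (rule finite_subset[of _ "V \<times> V"]) (auto simp: fin dest: M_D)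
  ultimately obtain X where "coherent X" "\<forall>p \<in> {p. M (fst p) (snd p)}. p \<in> X \<or> prod.swap p \<in> X" by blast
  then show ?thesis by (intro exI[of _ X]) auto
qed

section \<open>Missing edges outside the losing relation\<close>

definition losing_edge where "losing_edge u v \<longleftrightarrow> (\<exists>c d. loses u v c d) \<or> (\<exists>c d. loses c d u v)"

lemma losing_edge_sym: "losing_edge u v \<Longrightarrow> losing_edge v u"
  unfolding losing_edge_def using loses_swap by blast

text \<open>In the situation of \<open>pentagon\<close> the vertex \<open>v\<close> need not be reached from \<open>x\<close>, but \<open>u\<close> is, and this
  compensates for \<open>v\<close> in the final count.\<close>

definition pentagon where "pentagon x u v \<longleftrightarrow> (\<exists>c d. loses x u c d \<and> C5 u x d c v)"

context
  fixes X assumes ok: "coherent X"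
begin

text \<open>For \<open>x\<close> the last vertex of the median order, these will be exactly the arcs
  leaving it after its missing edges have been redirected.\<close>

definition ext_arc where "ext_arc x u \<longleftrightarrow> A x u \<or> ((x, u) \<in> X \<and> (\<exists>c d. loses x u c d))"

definition ext_convenient where "ext_convenient u v \<longleftrightarrow> (\<forall>x. ext_arc x u \<longrightarrow> reach2 x v \<or> pentagon x u v)"

text \<open>The pair \<open>(u, v)\<close> is not convenient, so some \<open>(a, b)\<close> in
  \<open>X\<close> loses to it. Any arc between \<open>z\<close> and \<open>b\<close> would complete
  an excluded route, so \<open>z b\<close> is missing and \<open>z\<close> must be
  \<open>a\<close>.\<close>

lemma beaten_by_witness:
  assumes "(u, v) \<in> X" "A z u" "\<not> reach2 z v"
  obtains b where "loses z b u v" "(z, b) \<in> X"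
proof -
  have "\<not> convenient u v" using assms unfolding convenient_def by blast
  then obtain p where p: "(p, (u, v)) \<in> losing" using ok assms(1) unfolding coherent_def by blast
  obtain a b where ab: "p = (a, b)" by (cases p)
  have l: "loses a b u v" "(a, b) \<in> X" using p ok assms(1) ab unfolding losing_def coherent_def by auto
  then have "A b v" "\<not> reach2 b u" unfolding loses_def by auto
  then have "\<not> A z b" "z \<noteq> b" "\<not> A b z" using assms reach2_arc reach2_path by blast+
  then have "M z b" using arc_or_M A_V \<open>A b v\<close> assms by blast
  then have "z = a" using P4_start_unique[OF loses_P4[OF l(1)]] A_D[OF assms(2)] by blast
  then show thesis using that l by blast
qed

lemma ext_convenient_one:
  assumes x: "(x, u) \<in> X" "loses x u c d" and y: "A y v" and uv: "M u v" "\<not> losing_edge u v"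
    and r: "\<not> reach2 x v" "\<not> reach2 y u"
  shows "pentagon x u v"
proof -
  have vx: "v \<noteq> x" using uv x(2) loses_swap unfolding losing_edge_def by blast
  have xc: "A x c" using x(2) unfolding loses_def by blast
  then have vc: "v \<noteq> c" using r reach2_arc by blast
  have xy: "x \<noteq> y" "\<not> A x y" using r y reach2_arc reach2_path by blast+
  \<comment> \<open>Otherwise \<open>x u\<close> would be beaten by an edge at \<open>y\<close>, and
    the resulting path would identify \<open>v\<close> with \<open>x\<close>.\<close>
  have "\<not> A y x"
  proof
    assume "A y x"
    then obtain b where "loses y b x u" using beaten_by_witness[OF x(1) _ r(2)] by blast
    then have "P4 u x b y \<or> P4 x u y b" using loses_P4 P4_rev by blast
    then show False using P4_start_unique[of x u y b v] uv(1) A_D[OF y] vx sym by blast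
  qed
  then have "M x y" using arc_or_M[of x y] xy xc y A_V by blast
  then have "C5 u x d c v" using end_edge_extension_path[OF loses_P4[OF x(2)] uv(1) vx vc] A_D[OF y] by blast
  then show ?thesis using x(2) unfolding pentagon_def C5_def by blast
qed

text \<open>An arc between \<open>x\<close> and \<open>y\<close> produces a losing edge at its tail
  and thereby a pentagon; a coincidence or a missing edge gives an impossible triangle or
  square.\<close>

lemma ext_convenient_two:
  assumes x: "(x, u) \<in> X" "loses x u c d" and y: "(y, v) \<in> X" "loses y v c' d'"
    and uv: "M u v" "\<not> losing_edge u v" and r: "\<not> reach2 x v" "\<not> reach2 y u"
  shows "pentagon x u v \<or> pentagon y v u"
proof -
  have vx: "v \<noteq> x" and uy: "u \<noteq> y" using uv x(2) y(2) loses_swap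
    unfolding losing_edge_def by blast+
  have xc: "A x c" "A y c'" using x(2) y(2) unfolding loses_def by blast+
  then have vc: "v \<noteq> c" "u \<noteq> c'" using r reach2_arc by blast+
  have "x \<noteq> y" using no_triangle_of_end_edges[OF loses_P4[OF x(2)] _ uv(1)] loses_P4[OF y(2)] by blast
  then consider "A x y" | "A y x" | "M x y" using arc_or_M[of x y] xc A_V by blast
  then show ?thesis
  proof cases
    case 1
    then obtain b where b: "loses x b y v" using beaten_by_witness[OF y(1) _ r(1)] by blast
    then have "b \<noteq> u" using uv(1) A_D unfolding loses_def by blast
    then have "C5 u x d c v"
      using end_edges_common_vertex[OF loses_P4[OF x(2)] loses_P4[OF b] uv(1) _ vc(1)] by blast
    then show ?thesis using x(2) unfolding pentagon_def C5_def by blast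
  next
    case 2
    then obtain b where b: "loses y b x u" using beaten_by_witness[OF x(1) _ r(2)] by blast
    then have "b \<noteq> v" using uv(1) A_D unfolding loses_def by blast
    then have "C5 v y d' c' u"
      using end_edges_common_vertex[OF loses_P4[OF y(2)] loses_P4[OF b] sym[OF uv(1)] _ vc(2)] by blast
    then show ?thesis using y(2) unfolding pentagon_def C5_def by blast
  next
    case 3
    then show ?thesis
      using no_square_of_end_edges[OF loses_P4[OF x(2)] loses_P4[OF y(2)] uv(1) _ vc uy vx] by blast
  qed
qed

lemma ext_convenient_total:
  assumes uv: "M u v" "\<not> losing_edge u v"
  shows "ext_convenient u v \<or> ext_convenient v u"
proof (rule ccontr)
  have vu: "M v u" "\<not> losing_edge v u" using uv sym losing_edge_sym by blast+
  assume "\<not> ?thesis"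
  then obtain x y where x: "ext_arc x u" "\<not> reach2 x v" "\<not> pentagon x u v"
    and y: "ext_arc y v" "\<not> reach2 y u" "\<not> pentagon y v u"
    unfolding ext_convenient_def by blast
  \<comment> \<open>Each obstacle is an arc or a kept missing edge. Two arcs would make
    \<open>u v\<close> beaten; the other cases are the two preceding lemmas.\<close>
  show False
    using x(1) y(1) losesI[OF uv(1)] x(2,3) y(2,3) uv(2)
      ext_convenient_one[of x u _ _ y v] ext_convenient_one[OF _ _ _ vu, of y _ _ x] ext_convenient_two[of x u _ _ y v] uv(1)
    unfolding ext_arc_def losing_edge_def by metis
qed

end

section \<open>The tournament and the final count\<close>

context
  fixes X assumes ok: "coherent X"
    and cover: "\<And>a b. M a b \<Longrightarrow> (a, b) \<in> X \<or> (b, a) \<in> X"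
begin

lemma tournament_exists:
  obtains T where "\<And>x y. A x y \<Longrightarrow> T x y" "\<And>x y. T x y \<Longrightarrow> A x y \<or> M x y"
    "\<And>x y. x \<in> V \<Longrightarrow> y \<in> V \<Longrightarrow> x \<noteq> y \<Longrightarrow> T x y \<noteq> T y x"
    "\<And>x y. losing_edge x y \<Longrightarrow> M x y \<Longrightarrow> T x y \<longleftrightarrow> (x, y) \<in> X"
    "\<And>x y. T x y \<Longrightarrow> M x y \<Longrightarrow> \<not> losing_edge x y \<Longrightarrow> ext_convenient X x y"
proof -
  \<comment> \<open>The numbering breaks ties between edges that are acceptable in both
    directions.\<close>
  obtain idx :: "'a \<Rightarrow> nat" where idx: "inj_on idx V"
    using finite_imp_inj_to_nat_seg[OF fin] by blast
  define T where "T x y \<longleftrightarrow> A x y \<or> (M x y \<and> (if losing_edge x y then (x, y) \<in> X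
    else ext_convenient X x y \<and> (\<not> ext_convenient X y x \<or> idx x < idx y)))" for x y
  have tour: "T x y \<noteq> T y x" if "x \<in> V" "y \<in> V" "x \<noteq> y" for x y
  proof (cases "M x y")
    case False
    then have "\<not> M y x" "A x y \<or> A y x" using arc_or_M[OF that] sym by blast+
    then show ?thesis using False asym unfolding T_def by blast
  next
    case True
    have i: "idx x < idx y \<longleftrightarrow> \<not> idx y < idx x" using idx that unfolding inj_on_def
      by (metis less_asym linorder_less_linear)
    have "(x, y) \<in> X \<longleftrightarrow> (y, x) \<notin> X" using cover[OF True] ok
      unfolding coherent_def by blast
    moreover have "losing_edge x y \<longleftrightarrow> losing_edge y x" using losing_edge_sym by blast
    moreover have "\<not> losing_edge x y \<Longrightarrow> ext_convenient X x y \<or> ext_convenient X y x" using ext_convenient_total[OF ok True] by blast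
    ultimately show ?thesis using True sym[OF True] M_D[OF True] i unfolding T_def by auto
  qed
  show thesis
    by (rule that[of T]) (use tour in \<open>auto simp: T_def dest: M_D split: if_splits\<close>)
qed

lemma seymour_vertex_of_coherent:
  assumes "V \<noteq> {}"
  shows "\<exists>f \<in> V. card {y. A f y} \<le> card {y. reach2 f y \<and> \<not> A f y}"
proof -
  obtain T where T: "\<And>x y. A x y \<Longrightarrow> T x y" "\<And>x y. T x y \<Longrightarrow> A x y \<or> M x y"
    "\<And>x y. x \<in> V \<Longrightarrow> y \<in> V \<Longrightarrow> x \<noteq> y \<Longrightarrow> T x y \<noteq> T y x"
    "\<And>x y. losing_edge x y \<Longrightarrow> M x y \<Longrightarrow> T x y \<longleftrightarrow> (x, y) \<in> X"
    "\<And>x y. T x y \<Longrightarrow> M x y \<Longrightarrow> \<not> losing_edge x y \<Longrightarrow> ext_convenient X x y"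
    using tournament_exists by blast
  obtain zs where zs: "distinct zs" "set zs = V" "feedback T zs" using feedback_order_exists[OF fin] by blast
  then obtain xs f where e: "zs = xs @ [f]" using assms by (metis set_empty rev_exhaust)
  have V: "V = insert f (set xs)" "f \<notin> set xs" "distinct xs" "f \<in> V" using e zs by auto
  define B where "B = {b. (f, b) \<in> X \<and> (\<exists>c d. loses f b c d)}"
  define N where "N = {y. A f y}"
  define P where "P = {y. reach2 f y \<and> \<not> A f y}"
  \<comment> \<open>\<open>Ds\<close> and \<open>Es\<close> collect the vertices that the modified
    tournament may reach from \<open>f\<close> in two steps although the digraph does not.\<close>
  define Ds where "Ds = {d. \<exists>b \<in> B. \<exists>c. loses f b c d}"
  define Es where "Es = {v. \<exists>b \<in> B. pentagon f b v}"
  define T' where "T' x y \<longleftrightarrow> (if x = f then A f y \<or> y \<in> B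
    else if y = f then \<not> A f x \<and> x \<notin> B else T x y)" for x y
  have BM: "M f b" if "b \<in> B" for b using that unfolding B_def loses_def by blast
  have BT: "T f b" if "b \<in> B" for b
    using that T(4)[OF _ BM[OF that]] unfolding B_def losing_edge_def by blast
  have sub: "N \<subseteq> set xs" "B \<subseteq> set xs" "P \<subseteq> V" "N \<inter> B = {}"
    using V A_D BM M_D unfolding N_def P_def reach2_def by blast+
  have finV: "finite S" if "S \<subseteq> V" for S using finite_subset[OF that fin] .
  have fins: "finite N" "finite B" "finite P" using sub V finV by blast+
  have feed': "feedback T' (xs @ [f])"
  proof (rule feedback_change_last)
    show "feedback T (xs @ [f])" using zs e by simp
    show "T' x y = T x y" if "x \<in> set xs" "y \<in> set xs" for x y using that V unfolding T'_def by auto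
    show "T f x" if "T' f x" for x using that T(1) BT unfolding T'_def by auto
    show "T' x f" if "x \<in> set xs" "T x f" for x
    proof -
      have "\<not> T f x" "x \<noteq> f" using T(3)[of x f] that V by auto
      then show ?thesis using T(1) BT unfolding T'_def by auto
    qed
  qed
  have tour: "T' x y \<noteq> T' y x"
    if "x \<in> set (xs @ [f])" "y \<in> set (xs @ [f])" "x \<noteq> y" for x y
    using T(3)[of x y] that V unfolding T'_def by auto
  let ?G = "\<lambda>y. T' y f \<and> (\<exists>x \<in> set xs. T' f x \<and> T' x y)"
  have "card ({y. T' f y} \<inter> set xs) \<le> card ({y. ?G y} \<inter> set xs)"
    using feed_vertex[OF feed' _ tour] zs(1) e distinct_length_filter[OF V(3)] by auto
  moreover have "{y. T' f y} \<inter> set xs = N \<union> B" using sub unfolding T'_def N_def by auto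
  ultimately have 1: "card N + card B \<le> card ({y. ?G y} \<inter> set xs)"
    using card_Un_disjoint[OF fins(1,2) sub(4)] by simp
  have 2: "{y. ?G y} \<inter> set xs \<subseteq> (P - B) \<union> Ds \<union> Es"
  proof
    fix y assume "y \<in> {y. ?G y} \<inter> set xs"
    then obtain x where y: "y \<in> set xs" "y \<noteq> f" "T' y f" "x \<in> set xs" "x \<noteq> f" "T' f x" "T' x y" using V by auto
    have nb: "y \<notin> B" "\<not> A f y" and fx: "A f x \<or> x \<in> B" and Txy: "T x y"
      using y V unfolding T'_def by auto
    show "y \<in> (P - B) \<union> Ds \<union> Es"
    proof (cases "reach2 f y")
      case True then show ?thesis using nb unfolding P_def by blast
    next
      case nr: False
      show ?thesis
      proof (cases "A x y")
        case xy: True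
        then have "x \<in> B" using fx nr reach2_path by blast
        then obtain c d where l: "loses f x c d" unfolding B_def by blast
        then have "A f c" "\<not> reach2 x c" unfolding loses_def by auto
        \<comment> \<open>No arc can join \<open>c\<close> and \<open>y\<close>, so
          \<open>c y\<close> is missing, and this forces \<open>y\<close> to be the partner
          \<open>d\<close> of \<open>c\<close>.\<close>
        then have "\<not> A c y" "\<not> A y c" "y \<noteq> c" using nr reach2_arc reach2_path xy nb by blast+
        then have "M y c" using arc_or_M \<open>A f c\<close> A_V xy by blast
        moreover have "P4 d c x f \<or> P4 c d f x" using loses_P4[OF l] P4_rev by blast
        ultimately have "y = d" using P4_start_unique[of d c x f y] A_D[OF xy] by blast
        then show ?thesis using l \<open>x \<in> B\<close> unfolding Ds_def by blast
      next
        case False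
        then have m: "M x y" using T(2)[OF Txy] by blast
        show ?thesis
        proof (cases "losing_edge x y")
          case sp: True
          then have xX: "(x, y) \<in> X" using T(4) m Txy by blast
          show ?thesis
          proof (cases "A f x")
            case True
            \<comment> \<open>The arc from \<open>f\<close> to \<open>x\<close> witnesses that
              \<open>x y\<close> is beaten by a kept edge at \<open>f\<close>, so \<open>y\<close>
              lies in \<open>Ds\<close>.\<close>
            then obtain b where "loses f b x y" "(f, b) \<in> X" using beaten_by_witness[OF ok xX _ nr]
              by blast
            then show ?thesis unfolding Ds_def B_def by blast
          next
            case False
            then have "x \<in> B" using fx by blast
            then obtain c d where l: "loses f x c d" unfolding B_def by blast
            then have "y \<noteq> c" using nr reach2_arc unfolding loses_def by blast
            moreover have "\<exists>p q. P4 x y p q \<or> P4 y x p q"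
              using sp loses_P4 P4_rev unfolding losing_edge_def by blast
            ultimately have "pentagon f x y"
              using adjacent_end_edges[OF loses_P4[OF l]] y(2) l unfolding pentagon_def C5_def by blast
            then show ?thesis using \<open>x \<in> B\<close> unfolding Es_def by blast
          qed
        next
          case False
          then have "ext_convenient X x y" using T(5) m Txy by blast
          moreover have "ext_arc X f x" using fx unfolding ext_arc_def[OF ok] B_def by blast
          ultimately have ex: "pentagon f x y" using nr unfolding ext_convenient_def[OF ok] by blast
          then have "M f x" unfolding pentagon_def loses_def by blast
          then have "x \<in> B" using fx M_D by blast
          then show ?thesis using ex unfolding Es_def by blast
        qed
      qed
    qed
  qed
  have 3: "card Ds \<le> card B"
    by (rule card_le_if_inj_on_rel[OF fins(2), of _ "\<lambda>d b. \<exists>c. loses f b c d"])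
      (use loses_det in \<open>auto simp: Ds_def\<close>)
  have pentagon: "b \<in> P" if ex: "pentagon f b v" for b v
  proof -
    obtain c d where l: "loses f b c d" "P4 b f d c" using ex unfolding pentagon_def C5_def by blast
    then have "tooth b f d c" using P4_D(11)[OF l(2)] P4_D(3)[of f b c d] loses_iff_tooth
      unfolding tooth_def by blast
    then have "A f c" "A c b" unfolding tooth_def by auto
    moreover have "M f b" using l unfolding loses_def by blast
    ultimately show ?thesis using reach2_path M_D unfolding P_def by blast
  qed
  \<comment> \<open>Each \<open>b\<close> determines at most one exceptional vertex and itself lies
    in \<open>P\<close>. Since \<open>P - B\<close> leaves \<open>b\<close> out, it pays for that
    vertex.\<close>
  have 4: "card Es \<le> card (B \<inter> P)"
  proof (rule card_le_if_inj_on_rel[of _ _ "\<lambda>v b. pentagon f b v"])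
    show "finite (B \<inter> P)" using fins by blast
    show "\<exists>b. b \<in> B \<inter> P \<and> pentagon f b v" if "v \<in> Es" for v
      using that pentagon unfolding Es_def by blast
    show "v = v'" if "pentagon f b v" "pentagon f b v'" for v v' b
      using that loses_det C5_unique unfolding pentagon_def by blast
  qed
  have "Ds \<subseteq> V" "Es \<subseteq> V"
    unfolding Ds_def Es_def pentagon_def loses_def C5_def using M_D by blast+
  then have "card ({y. ?G y} \<inter> set xs) \<le> card ((P - B) \<union> Ds \<union> Es)"
    using 2 fins finV by (intro card_mono) auto
  also have "\<dots> \<le> card (P - B) + card Ds + card Es"
    by (meson add_le_mono1 card_Un_le order_trans)
  finally have "card N + card B \<le> card (P - B) + card B + card (B \<inter> P)" using 1 3 4 by linarith
  moreover have "card P = card (P - B) + card (B \<inter> P)"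
    using card_Int_Diff[OF fins(3), of B] by (simp add: Int_commute)
  ultimately have "card N \<le> card P" by simp
  then show ?thesis using V(4) unfolding N_def P_def by blast
qed
end

theorem seymour_vertex: "V \<noteq> {} \<Longrightarrow> \<exists>f \<in> V. card {y. A f y} \<le> card {y. reach2 f y \<and> \<not> A f y}"
  using coherent_exists seymour_vertex_of_coherent by blast

end

section \<open>Induced subgraphs of the missing graph\<close>

text \<open>The isomorphism runs from the induced copy to \<open>H\<close>, so its vertex map is the
  inverse of \<open>h\<close>.\<close>

lemma contains_inducedI:
  assumes G: "wf_digraph (with_proj G)" and inj: "inj_on h (pverts H)"
    and sub: "h ` pverts H \<subseteq> pverts G"
    and H: "parcs H \<subseteq> pverts H \<times> pverts H"
    and arcs: "\<And>x y. x \<in> pverts H \<Longrightarrow> y \<in> pverts H \<Longrightarrow> (x, y) \<in> parcs H \<longleftrightarrow> (h x, h y) \<in> parcs G"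
  shows "contains_induced G H"
proof -
  define K where "K = with_proj G \<restriction> h ` pverts H"
  define k where "k = the_inv_into (pverts H) h"
  have k: "k (h x) = x" if "x \<in> pverts H" for x using that inj
    unfolding k_def by (simp add: the_inv_into_f_f)
  have K: "verts K = h ` pverts H"
    "arcs K = (\<lambda>(x, y). (h x, h y)) ` parcs H" "tail K = fst" "head K = snd"
    using H arcs unfolding K_def by (auto simp: image_iff) (metis case_prod_conv)
  have ind: "induced_subgraph K (with_proj G)"
    unfolding K_def using wf_digraph.induced_induce[OF G] sub by simp
  then have wf: "wf_digraph K" by (auto simp: induced_subgraph_def subgraph_def)
  let ?f = "\<lparr>iso_verts = k, iso_arcs = map_prod k k, iso_head = snd, iso_tail = fst\<rparr>"
  have "pre_digraph.digraph_isomorphism K ?f"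
    unfolding pre_digraph.digraph_isomorphism_def K digraph_isomorphism.simps
    using H wf by (auto simp: inj_on_def k subset_iff split_beta)
  moreover have "with_proj H = app_iso ?f K"
    unfolding with_proj_def app_iso_def K digraph_isomorphism.simps
    using H by (force simp: k image_image image_iff)
  ultimately show ?thesis using ind unfolding contains_induced_def digraph_iso_def by blast
qed

text \<open>By \<open>iso\<close> every \<open>h x\<close> lies on a missing edge, hence in the
  missing graph, from where the isomorphism with \<open>G\<close> transports the copy.\<close>

lemma contains_induced_of_missing:
  assumes G: "pair_graph G" and D: "is_missing D G" and inj_h: "inj_on h (pverts H)"
    and arcs: "\<forall>x \<in> pverts H. \<forall>y \<in> pverts H. (x, y) \<in> parcs H \<longleftrightarrow> (h x, h y) \<in> missing_arcs D"
    and H: "parcs H \<subseteq> pverts H \<times> pverts H"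
      and iso: "\<forall>x \<in> pverts H. \<exists>y \<in> pverts H. (x, y) \<in> parcs H"
  shows "contains_induced G H"
proof -
  interpret pair_graph G by fact
  obtain f where f: "pre_digraph.digraph_isomorphism (with_proj (missing_graph D)) f"
      "with_proj G = app_iso f (with_proj (missing_graph D))"
    using D unfolding is_missing_def digraph_iso_def by blast
  define g where "g = iso_verts f"
  have G_eq: "pverts G = g ` pverts (missing_graph D)" "parcs G = iso_arcs f ` missing_arcs D"
    "iso_tail f = fst" "iso_head f = snd"
    using f(2) unfolding with_proj_def app_iso_def g_def by (auto simp: missing_graph_def)
  have inj: "inj_on g (pverts (missing_graph D))"
    and "\<forall>a \<in> missing_arcs D. iso_arcs f a = map_prod g g a"
    using f(1) unfolding pre_digraph.digraph_isomorphism_def G_eq(3,4) g_def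
    by (auto simp: missing_graph_def prod_eq_iff)
  then have parcs: "parcs G = map_prod g g ` missing_arcs D" unfolding G_eq(2) by (auto simp: image_iff)
  have verts: "h x \<in> pverts (missing_graph D)" if "x \<in> pverts H" for x
    using iso that arcs unfolding missing_graph_def by fastforce
  have miss: "x \<in> pverts (missing_graph D) \<and> y \<in> pverts (missing_graph D)"
    if "(x, y) \<in> missing_arcs D" for x y
    using that unfolding missing_graph_def missing_arcs_def by auto
  have gm: "(g x, g y) \<in> parcs G \<longleftrightarrow> (x, y) \<in> missing_arcs D"
    if "x \<in> pverts (missing_graph D)" "y \<in> pverts (missing_graph D)" for x y
  proof
    assume "(g x, g y) \<in> parcs G"
    then obtain x' y' where "(x', y') \<in> missing_arcs D" "g x = g x'" "g y = g y'" unfolding parcs by auto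
    then show "(x, y) \<in> missing_arcs D" using miss[of x' y'] inj_onD[OF inj] that by metis
  qed (auto simp: parcs)
  show ?thesis
  proof (rule contains_inducedI[where h = "g \<circ> h"])
    show "wf_digraph (with_proj G)" by unfold_locales
    show "inj_on (g \<circ> h) (pverts H)"
      using verts by (intro comp_inj_on inj_h inj_on_subset[OF inj]) auto
    show "(g \<circ> h) ` pverts H \<subseteq> pverts G" using verts G_eq(1) by auto
    show "(x, y) \<in> parcs H \<longleftrightarrow> ((g \<circ> h) x, (g \<circ> h) y) \<in> parcs G"
      if "x \<in> pverts H" "y \<in> pverts H" for x y
      using arcs gm[OF verts verts, OF that] that by simp
  qed fact
qed

lemma parcs_graph_of_edges:
  assumes "\<forall>e \<in> E. e \<subseteq> V"
  shows "parcs (graph_of_edges V E) \<subseteq> pverts (graph_of_edges V E) \<times> pverts (graph_of_edges V E)"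
proof
  fix p assume "p \<in> parcs (graph_of_edges V E)"
  then have "{fst p, snd p} \<in> E" unfolding graph_of_edges_def by auto
  then have "{fst p, snd p} \<subseteq> V" using assms by blast
  then show "p \<in> pverts (graph_of_edges V E) \<times> pverts (graph_of_edges V E)"
    unfolding graph_of_edges_def by (simp add: mem_Times_iff)
qed

lemma parcs_graph_complement:
  "parcs (graph_complement H) \<subseteq> pverts (graph_complement H) \<times> pverts (graph_complement H)"
  unfolding graph_complement_def by auto

lemma cycle_graph_4: "cycle_graph 4 = graph_of_edges {0, 1, 2, 3} {{0, 1}, {1, 2}, {2, 3}, {3, 0}}"
proof -
  have 1: "{i. i < 4} = {0, 1, 2, 3 :: nat}" by auto
  have "{{i, Suc i mod 4} | i :: nat. i < 4} = (\<lambda>i. {i, Suc i mod 4}) ` {i. i < 4}" by blast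
  also have "\<dots> = {{0, 1}, {1, 2}, {2, 3}, {3, 0}}"
  proof -
    have "Suc 0 mod 4 = 1" "Suc 1 mod 4 = 2" "Suc 2 mod 4 = 3" "Suc 3 mod 4 = 0" by simp_all
    then show ?thesis unfolding 1 by (simp only: image_insert image_empty)
  qed
  finally show ?thesis unfolding cycle_graph_def lessThan_def 1 by (simp only:)
qed

lemma missing_forbidden_free:
  fixes G :: "'b pair_pre_digraph" and D :: "'a pair_pre_digraph"
  assumes G: "pair_graph G" and D: "is_missing D G"
    and free: "\<not> contains_induced G (cycle_graph 4)"
    "\<not> contains_induced G (graph_complement (cycle_graph 4))"
    "\<not> contains_induced G three_sun"
    "\<not> contains_induced G chair"
    "\<not> contains_induced G co_chair"
  shows "forbidden_free (\<lambda>x y. (x, y) \<in> missing_arcs D)"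
proof -
  let ?M = "\<lambda>x y. (x, y) \<in> missing_arcs D"
  note embed = contains_induced_of_missing[OF G D]
  have sym: "?M x y \<Longrightarrow> ?M y x" for x y unfolding missing_arcs_def by auto
  have irr: "\<not> ?M x x" for x unfolding missing_arcs_def by auto
  have wf: "parcs (cycle_graph 4) \<subseteq> pverts (cycle_graph 4) \<times> pverts (cycle_graph 4)"
    "parcs three_sun \<subseteq> pverts three_sun \<times> pverts three_sun" "parcs chair \<subseteq> pverts chair \<times> pverts chair"
    unfolding cycle_graph_4 three_sun_def chair_def by (rule parcs_graph_of_edges; simp)+
  note wf = wf parcs_graph_complement parcs_graph_complement[of chair, folded co_chair_def]
  note defs = cycle_graph_4 graph_complement_def co_chair_def chair_def three_sun_def graph_of_edges_def
  show ?thesis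
  proof (unfold_locales)
    fix a b c d assume p: "?M a b" "?M b c" "?M c d" "?M d a" and ne: "a \<noteq> c" "b \<noteq> d"
    show "?M a c \<or> ?M b d"
    proof (rule ccontr)
      assume n: "\<not> ?thesis"
      have n': "\<not> ?M c a" "\<not> ?M d b" using n sym by blast+
      have "distinct [a, b, c, d]" using p n n' irr ne by auto
      then have "contains_induced G (cycle_graph 4)"
        by (intro embed[of "(!) [a, b, c, d]"] wf) (use p p[THEN sym] n n' irr in \<open>simp_all add: defs doubleton_eq_iff\<close>)
      then show False using free by blast
    qed
  next
    fix a b c d assume p: "?M a b" "?M c d"
    show "?M a c \<or> ?M a d \<or> ?M b c \<or> ?M b d"
    proof (rule ccontr)
      assume n: "\<not> ?thesis"
      have n': "\<not> ?M c a" "\<not> ?M d a" "\<not> ?M c b" "\<not> ?M d b" using n sym by blast+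
      \<comment> \<open>The complement of the 4-cycle joins position 0 to 2 and 1 to 3, hence the
        interleaved order.\<close>
      have "distinct [a, c, b, d]" using p n n' irr by auto
      then have "contains_induced G (graph_complement (cycle_graph 4))"
        by (intro embed[of "(!) [a, c, b, d]"] wf) (use p p[THEN sym] n n' irr in \<open>simp_all add: defs doubleton_eq_iff\<close>)
      then show False using free by blast
    qed
  next
    fix x y z t v assume p: "?M x y" "?M y z" "?M z t" "?M z v" and ne: "t \<noteq> v"
    show "?M x z \<or> ?M x t \<or> ?M x v \<or> ?M y t \<or> ?M y v \<or> ?M t v"
    proof (rule ccontr)
      assume n: "\<not> ?thesis"
      have n': "\<not> ?M z x" "\<not> ?M t x" "\<not> ?M v x" "\<not> ?M t y" "\<not> ?M v y" "\<not> ?M v t" using n sym by blast+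
      have "distinct [x, y, z, t, v]" using p n n' irr ne by auto
      then have "contains_induced G chair"
        by (intro embed[of "(!) [x, y, z, t, v]"] wf) (use p p[THEN sym] n n' irr in \<open>simp_all add: defs doubleton_eq_iff\<close>)
      then show False using free by blast
    qed
  next
    fix x t v y z assume p: "?M x t" "?M x v" "?M t v" "?M y t" "?M y v" "?M x z" and ne: "x \<noteq> y"
    show "?M x y \<or> ?M y z \<or> ?M z t \<or> ?M z v"
    proof (rule ccontr)
      assume n: "\<not> ?thesis"
      have n': "\<not> ?M y x" "\<not> ?M z y" "\<not> ?M t z" "\<not> ?M v z" using n sym by blast+
      have "distinct [x, y, z, t, v]" using p n n' irr ne by auto
      then have "contains_induced G co_chair"
        by (intro embed[of "(!) [x, y, z, t, v]"] wf) (use p p[THEN sym] n n' irr in \<open>simp_all add: defs doubleton_eq_iff\<close>)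
      then show False using free by blast
    qed
  next
    fix a b c p q r assume p: "?M a b" "?M b c" "?M c a" "?M p a" "?M p b" "?M q b" "?M q c" "?M r a" "?M r c"
    show "?M p c \<or> ?M q a \<or> ?M r b \<or> ?M p q \<or> ?M q r \<or> ?M p r \<or> p = c \<or> q = a \<or> r = b"
    proof (rule ccontr)
      assume n: "\<not> ?thesis"
      have n': "\<not> ?M c p" "\<not> ?M a q" "\<not> ?M b r" "\<not> ?M q p" "\<not> ?M r q" "\<not> ?M r p" using n sym by blast+
      have "distinct [a, b, c, p, q, r]" using p n n' irr by auto
      then have "contains_induced G three_sun"
        by (intro embed[of "(!) [a, b, c, p, q, r]"] wf) (use p p[THEN sym] n n' irr in \<open>simp_all add: defs doubleton_eq_iff\<close>)
      then show False using free by blast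
    qed
  qed (use sym irr in auto)
qed

theorem mainTheorem1:
  fixes G :: "'b pair_pre_digraph" and D :: "'a pair_pre_digraph"
  assumes "pair_graph G"
    and "\<not> contains_induced G (cycle_graph 4)"
    and "\<not> contains_induced G (graph_complement (cycle_graph 4))"
    and "\<not> contains_induced G three_sun"
    and "\<not> contains_induced G chair"
    and "\<not> contains_induced G co_chair"
    and "oriented_graph D"
    and "pverts D \<noteq> {}"
    and "is_missing D G"
  shows "\<exists>v \<in> pverts D. out_deg D v \<le> second_out_deg D v"
proof -
  interpret D: oriented_graph D by fact
  interpret forbidden_free "\<lambda>x y. (x, y) \<in> missing_arcs D"
    by (rule missing_forbidden_free) fact+
  interpret oriented_missing "\<lambda>x y. (x, y) \<in> missing_arcs D" "pverts D" "\<lambda>x y. (x, y) \<in> parcs D"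
    by unfold_locales
      (use D.no_two_cycles D.pair_finite_verts D.in_arcsD1 D.in_arcsD2 in \<open>auto simp: missing_arcs_def\<close>)
  obtain f where f: "f \<in> pverts D"
    "card {y. (f, y) \<in> parcs D} \<le> card {y. reach2 f y \<and> (f, y) \<notin> parcs D}"
    using seymour_vertex \<open>pverts D \<noteq> {}\<close> by blast
  have "out_nbrs D f = {y. (f, y) \<in> parcs D}"
    "second_out_nbrs D f = {y. reach2 f y \<and> (f, y) \<notin> parcs D}"
    using A_V unfolding out_nbrs_def second_out_nbrs_def reach2_def by blast+
  then show ?thesis using f unfolding out_deg_def second_out_deg_def by (intro bexI[of _ f]) simp_all
qed

end
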